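(* Let $X$ be any group, and let $G=(X\times X)\rtimes\langle\alpha\rangle$, where $\alpha$ has order $2$ and acts on $X\times X$ by $\alpha(x,y)\alpha^{-1}=(y,x)$ for all $(x,y)\in X\times X$. Let $H=\{(x,x)\mid x\in X\}\leqslant X\times X$ be the diagonal subgroup and let $A=C_G(\alpha)=H\langle\alpha\rangle$. If $A$ is a virtual retract of $G$, then $X\cong H$ has an abelian subgroup of finite index.
   Context: $C_G(\alpha)$ denotes the centralizer of $\alpha$ in $G$. A subgroup $H$ of a group $K$ is a retract of $K$ if there is a homomorphism $\rho: K \to H$ which restricts to the identity map on $H$. A subgroup $H$ of a group $G$ is a virtual retract of $G$ if there exists a subgroup $K \leqslant G$ with $|G:K|<\infty$, $H \subseteq K$, and $H$ a retract of $K$. *)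

theory Defs
  imports "HOL-Algebra.Elementary_Groups" "HOL-Algebra.Bij"
begin

definition centralizer :: "('a, 'b) monoid_scheme \<Rightarrow> 'a \<Rightarrow> 'a set" where
  "centralizer G a = {g \<in> carrier G. g \<otimes>\<^bsub>G\<^esub> a = a \<otimes>\<^bsub>G\<^esub> g}"

text \<open>Finiteness of the index is expressed by finiteness of the set of right cosets, since
  \<open>card\<close> of that set would be 0 for a subgroup of infinite index.\<close>

definition finite_index :: "'a set \<Rightarrow> ('a, 'b) monoid_scheme \<Rightarrow> bool" where
  "finite_index K G \<longleftrightarrow> finite (rcosets\<^bsub>G\<^esub> K)"

definition retract_of :: "'a set \<Rightarrow> ('a, 'b) monoid_scheme \<Rightarrow> bool" where
  "retract_of H K \<longleftrightarrow> subgroup H K \<and> (\<exists>\<rho> \<in> hom K (K\<lparr>carrier := H\<rparr>). \<forall>h\<in>H. \<rho> h = h)"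

definition virtual_retract :: "'a set \<Rightarrow> ('a, 'b) monoid_scheme \<Rightarrow> bool" where
  "virtual_retract H G \<longleftrightarrow> subgroup H G \<and>
     (\<exists>K. subgroup K G \<and> finite_index K G \<and> H \<subseteq> K \<and> retract_of H (G\<lparr>carrier := K\<rparr>))"

definition semidirect_product ::
  "('n, 'c) monoid_scheme \<Rightarrow> ('k, 'd) monoid_scheme \<Rightarrow> ('k \<Rightarrow> 'n \<Rightarrow> 'n) \<Rightarrow> ('n \<times> 'k) monoid" where
  "semidirect_product N K \<phi> =
    \<lparr>carrier = carrier N \<times> carrier K,
     monoid.mult = (\<lambda>(n, k) (n', k'). (n \<otimes>\<^bsub>N\<^esub> \<phi> k n', k \<otimes>\<^bsub>K\<^esub> k')),
     monoid.one = (\<one>\<^bsub>N\<^esub>, \<one>\<^bsub>K\<^esub>)\<rparr>"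

lemma AutoGroup_mult:
  assumes "f \<in> auto N" "g \<in> auto N"
  shows "f \<otimes>\<^bsub>AutoGroup N\<^esub> g = compose (carrier N) f g"
  using assms by (simp add: AutoGroup_def BijGroup_def auto_def)

lemma group_semidirect_product:
  assumes N: "group N" and K: "group K" and \<phi>: "\<phi> \<in> hom K (AutoGroup N)"
  shows "group (semidirect_product N K \<phi>)"
proof -
  interpret N: group N by fact
  interpret K: group K by fact
  have aut: "\<phi> k \<in> auto N" if "k \<in> carrier K" for k
    using hom_in_carrier[OF \<phi> that] by (simp add: AutoGroup_def)
  have hom: "\<phi> k \<in> hom N N" if "k \<in> carrier K" for k
    using aut[OF that] by (simp add: auto_def)
  note cl = hom_in_carrier[OF hom] and mu = hom_mult[OF hom]
  have comp: "\<phi> (k \<otimes>\<^bsub>K\<^esub> l) n = \<phi> k (\<phi> l n)"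
    if "k \<in> carrier K" "l \<in> carrier K" "n \<in> carrier N" for k l n
    using hom_mult[OF \<phi> that(1,2)] AutoGroup_mult[OF aut[OF that(1)] aut[OF that(2)]] that
    by (simp add: compose_def)
  have one: "\<phi> \<one>\<^bsub>K\<^esub> n = n" if "n \<in> carrier N" for n
    using hom_one[OF \<phi> K N.AutoGroup] that by (simp add: AutoGroup_def BijGroup_def)
  show ?thesis
  proof (rule groupI)
    fix x assume "x \<in> carrier (semidirect_product N K \<phi>)"
    then obtain n k where x: "x = (n, k)" "n \<in> carrier N" "k \<in> carrier K"
      by (auto simp: semidirect_product_def)
    let ?y = "(\<phi> (inv\<^bsub>K\<^esub> k) (inv\<^bsub>N\<^esub> n), inv\<^bsub>K\<^esub> k)"
    have "\<phi> (inv\<^bsub>K\<^esub> k) (inv\<^bsub>N\<^esub> n) \<otimes>\<^bsub>N\<^esub> \<phi> (inv\<^bsub>K\<^esub> k) n = \<one>\<^bsub>N\<^esub>"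
      using x mu[of "inv\<^bsub>K\<^esub> k" "inv\<^bsub>N\<^esub> n" n] hom_one[OF hom N N] by simp
    then show "\<exists>y\<in>carrier (semidirect_product N K \<phi>).
        y \<otimes>\<^bsub>semidirect_product N K \<phi>\<^esub> x = \<one>\<^bsub>semidirect_product N K \<phi>\<^esub>"
      using x cl by (intro bexI[of _ ?y]) (auto simp: semidirect_product_def)
  qed (auto simp: semidirect_product_def cl mu comp one N.m_assoc K.m_assoc)
qed

text \<open>The group \<open>\<langle>\<alpha>\<rangle>\<close> of order 2 is \<open>\<int>/2\<close>, with \<open>\<alpha>\<close> corresponding to the residue 1, acting
  on \<open>X \<times> X\<close> by interchanging the coordinates. The actions are restricted to the carrier because
  the elements of \<open>AutoGroup\<close> are extensional functions.\<close>

definition swap_action :: "('a, 'b) monoid_scheme \<Rightarrow> int \<Rightarrow> 'a \<times> 'a \<Rightarrow> 'a \<times> 'a" where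
  "swap_action X k = restrict (if k = 1 then prod.swap else id) (carrier (X \<times>\<times> X))"

definition swap_product :: "('a, 'b) monoid_scheme \<Rightarrow> (('a \<times> 'a) \<times> int) monoid" where
  "swap_product X = semidirect_product (X \<times>\<times> X) (integer_mod_group 2) (swap_action X)"

definition swap_elt :: "('a, 'b) monoid_scheme \<Rightarrow> ('a \<times> 'a) \<times> int" where
  "swap_elt X = (\<one>\<^bsub>X \<times>\<times> X\<^esub>, 1)"

text \<open>As a subset of the semidirect product, \<open>X \<times> X\<close> consists of the pairs with second
  component 0.\<close>

definition diagonal :: "('a, 'b) monoid_scheme \<Rightarrow> (('a \<times> 'a) \<times> int) set" where
  "diagonal X = {((x, x), 0) | x. x \<in> carrier X}"

lemma swap_action_hom:
  assumes "group X"
  shows "swap_action X \<in> hom (integer_mod_group 2) (AutoGroup (X \<times>\<times> X))"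
proof -
  interpret X: group X by fact
  have C: "carrier (integer_mod_group 2) = {0, 1}"
    by (auto simp: carrier_integer_mod_group)
  have aut: "swap_action X k \<in> auto (X \<times>\<times> X)" for k
  proof -
    have "bij_betw (swap_action X k) (carrier (X \<times>\<times> X)) (carrier (X \<times>\<times> X))"
      by (rule bij_betw_byWitness[where f' = "swap_action X k"])
        (auto simp: swap_action_def)
    then show ?thesis
      by (auto simp: auto_def Bij_def hom_def swap_action_def)
  qed
  show ?thesis
  proof (rule homI)
    fix k l assume "k \<in> carrier (integer_mod_group 2)" "l \<in> carrier (integer_mod_group 2)"
    then show "swap_action X (k \<otimes>\<^bsub>integer_mod_group 2\<^esub> l) =
        swap_action X k \<otimes>\<^bsub>AutoGroup (X \<times>\<times> X)\<^esub> swap_action X l"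
      unfolding AutoGroup_mult[OF aut aut] C
      by (auto simp: fun_eq_iff swap_action_def compose_def)
  qed (use aut in \<open>simp add: AutoGroup_def\<close>)
qed

lemma group_swap_product: "group X \<Longrightarrow> group (swap_product X)"
  unfolding swap_product_def
  by (intro group_semidirect_product swap_action_hom DirProd_group) auto

lemma swap_elt_order_2:
  assumes "group X"
  shows "swap_elt X \<in> carrier (swap_product X)" "swap_elt X \<noteq> \<one>\<^bsub>swap_product X\<^esub>"
    and "swap_elt X \<otimes>\<^bsub>swap_product X\<^esub> swap_elt X = \<one>\<^bsub>swap_product X\<^esub>"
proof -
  interpret X: group X by fact
  show "swap_elt X \<in> carrier (swap_product X)" "swap_elt X \<noteq> \<one>\<^bsub>swap_product X\<^esub>"
    "swap_elt X \<otimes>\<^bsub>swap_product X\<^esub> swap_elt X = \<one>\<^bsub>swap_product X\<^esub>"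
    by (auto simp: swap_elt_def swap_product_def semidirect_product_def swap_action_def
        carrier_integer_mod_group)
qed

lemma swap_elt_conj:
  assumes "group X" "x \<in> carrier X" "y \<in> carrier X"
  shows "swap_elt X \<otimes>\<^bsub>swap_product X\<^esub> ((x, y), 0) \<otimes>\<^bsub>swap_product X\<^esub> inv\<^bsub>swap_product X\<^esub> swap_elt X
    = ((y, x), 0)"
proof -
  interpret X: group X by fact
  have "inv\<^bsub>swap_product X\<^esub> swap_elt X = swap_elt X"
    using swap_elt_order_2[OF assms(1)] group_swap_product[OF assms(1)]
    by (simp add: group.inv_equality)
  then show ?thesis
    using assms by (simp add: swap_elt_def swap_product_def semidirect_product_def swap_action_def)
qed

end

(* If rho retracts a finite-index subgroup K onto A = C_G(alpha), then rho(x,1) commutes with alpha,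
   so conjugating by alpha gives rho(x,1) = rho(1,x). Since (x,1) commutes with (1,y), all the
   elements rho(x,1) commute with each other, hence so do their squares
   rho(x,1) rho(1,x) = rho(x,x) = (x,x). Thus the finite-index subgroup {x. (x,1) : K} of X
   is abelian. *)
theory Submission
  imports Defs
begin

text \<open>Each right coset of the preimage is itself the preimage of a right coset of
  \<open>K\<close>, so taking preimages maps the finite set of cosets of \<open>K\<close> onto a set
  containing all cosets of the preimage. This is what transfers finite index from
  \<open>swap_product X\<close> down to \<open>X\<close>.\<close>

lemma finite_index_vimage:
  assumes G: "group G" and H: "group H" and f: "f \<in> hom G H"
    and K: "subgroup K H" and fin: "finite_index K H"
  shows "subgroup {g \<in> carrier G. f g \<in> K} G" "finite_index {g \<in> carrier G. f g \<in> K} G"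
proof -
  interpret group_hom G H f
    using G H f by (simp add: group_hom_def group_hom_axioms_def)
  interpret K: subgroup K H by fact
  let ?B = "{g \<in> carrier G. f g \<in> K}"
  show B: "subgroup ?B G"
    by (rule G.subgroupI) auto
  have "?B #>\<^bsub>G\<^esub> x = {g \<in> carrier G. f g \<in> K #>\<^bsub>H\<^esub> f x}" if x: "x \<in> carrier G" for x
  proof (intro equalityI subsetI)
    fix g assume "g \<in> ?B #>\<^bsub>G\<^esub> x"
    then show "g \<in> {g \<in> carrier G. f g \<in> K #>\<^bsub>H\<^esub> f x}"
      using x by (auto simp: r_coset_def)
  next
    fix g assume "g \<in> {g \<in> carrier G. f g \<in> K #>\<^bsub>H\<^esub> f x}"
    then obtain k where g: "g \<in> carrier G" and k: "k \<in> K" "f g = k \<otimes>\<^bsub>H\<^esub> f x"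
      by (auto simp: r_coset_def)
    \<comment> \<open>The element of \<open>?B\<close> that carries \<open>x\<close> to
      \<open>g\<close> is \<open>g\<close> times the inverse of \<open>x\<close>: its image cancels
      \<open>f x\<close> and leaves \<open>k\<close>.\<close>
    have "f (g \<otimes>\<^bsub>G\<^esub> inv\<^bsub>G\<^esub> x) = k"
      using g k x K.mem_carrier by (simp add: H.m_assoc)
    moreover have "g = g \<otimes>\<^bsub>G\<^esub> inv\<^bsub>G\<^esub> x \<otimes>\<^bsub>G\<^esub> x"
      using g x by (simp add: G.m_assoc)
    ultimately show "g \<in> ?B #>\<^bsub>G\<^esub> x"
      unfolding r_coset_def using g x k by blast
  qed
  then have "rcosets\<^bsub>G\<^esub> ?B \<subseteq> (\<lambda>C. {g \<in> carrier G. f g \<in> C}) ` (rcosets\<^bsub>H\<^esub> K)"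
    using H.rcosetsI[OF K.subset] by (auto simp: RCOSETS_def[of G] intro!: imageI)
  then show "finite_index ?B G"
    using fin unfolding finite_index_def by (rule finite_surj[rotated])
qed

text \<open>Applying \<open>\<rho>\<close> to the relation between \<open>x\<close> and
  \<open>x'\<close> gives an equation in which \<open>a\<close> stands on different sides; the
  values of \<open>\<rho>\<close> commute with \<open>a\<close>, so \<open>a\<close> can be moved
  across and cancelled.\<close>

lemma hom_centralizer_conj_eq:
  assumes G: "group G" and K: "subgroup K G"
    and \<rho>: "\<rho> \<in> hom (G\<lparr>carrier := K\<rparr>) (G\<lparr>carrier := centralizer G a\<rparr>)"
    and a: "a \<in> K" "\<rho> a = a" and x: "x \<in> K" "x' \<in> K" "a \<otimes>\<^bsub>G\<^esub> x = x' \<otimes>\<^bsub>G\<^esub> a"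
  shows "\<rho> x' = \<rho> x"
proof -
  interpret group G by fact
  interpret K: subgroup K G by fact
  have cl: "\<rho> x \<in> centralizer G a" "\<rho> x' \<in> centralizer G a"
    using \<rho> x by (auto simp: hom_def)
  have mult: "\<rho> (u \<otimes>\<^bsub>G\<^esub> v) = \<rho> u \<otimes>\<^bsub>G\<^esub> \<rho> v" if "u \<in> K" "v \<in> K" for u v
    using hom_mult[OF \<rho>, of u v] that by simp
  have "\<rho> x' \<otimes>\<^bsub>G\<^esub> a = a \<otimes>\<^bsub>G\<^esub> \<rho> x"
    using mult[of a x] mult[of x' a] x a by simp
  also have "\<dots> = \<rho> x \<otimes>\<^bsub>G\<^esub> a"
    using cl by (simp add: centralizer_def)
  finally show ?thesis
    by (rule right_cancel[THEN iffD1, rotated 3])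
      (use cl K.mem_carrier[OF a(1)] in \<open>auto simp: centralizer_def\<close>)
qed

text \<open>Coordinate formulas for all later computations. Membership of \<open>u\<close> and
  \<open>v\<close> is assumed because \<open>swap_action\<close> is restricted to the
  carrier.\<close>

lemma swap_product_simps:
  "carrier (swap_product X) = (carrier X \<times> carrier X) \<times> {0, 1}"
  "\<one>\<^bsub>swap_product X\<^esub> = ((\<one>\<^bsub>X\<^esub>, \<one>\<^bsub>X\<^esub>), 0)"
  "\<lbrakk>u \<in> carrier X; v \<in> carrier X\<rbrakk> \<Longrightarrow> ((x, y), k) \<otimes>\<^bsub>swap_product X\<^esub> ((u, v), l) =
    ((x \<otimes>\<^bsub>X\<^esub> (if k = 1 then v else u), y \<otimes>\<^bsub>X\<^esub> (if k = 1 then u else v)), (k + l) mod 2)"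
  by (auto simp: swap_product_def semidirect_product_def swap_action_def carrier_integer_mod_group)

lemma swap_elt_eq: "swap_elt X = ((\<one>\<^bsub>X\<^esub>, \<one>\<^bsub>X\<^esub>), 1)"
  by (simp add: swap_elt_def)

text \<open>Multiplying \<open>((x, y), k)\<close> by \<open>swap_elt X\<close> on the right keeps
  the coordinates, on the left it interchanges them; the residues agree in both cases.\<close>

lemma centralizer_swap_elt:
  assumes "group X"
  shows "centralizer (swap_product X) (swap_elt X) = {((x, x), k) | x k. x \<in> carrier X \<and> k \<in> {0, 1}}"
proof -
  interpret X: group X by fact
  have "g \<in> centralizer (swap_product X) (swap_elt X) \<longleftrightarrow>
      (\<exists>x k. g = ((x, x), k) \<and> x \<in> carrier X \<and> k \<in> {0, 1})" for g
  proof -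
    obtain x y k where g: "g = ((x, y), k)"
      by (metis prod.exhaust)
    have "((x, y), k) \<otimes>\<^bsub>swap_product X\<^esub> swap_elt X = swap_elt X \<otimes>\<^bsub>swap_product X\<^esub> ((x, y), k) \<longleftrightarrow>
        x = y" if "x \<in> carrier X" "y \<in> carrier X"
      using that by (simp add: swap_elt_eq swap_product_simps add.commute[of 1 k] eq_commute[of y x])
    then show ?thesis
      unfolding g centralizer_def swap_product_simps(1) by blast
  qed
  then show ?thesis
    by blast
qed

text \<open>The involution is its own inverse, so together with the identity it already forms a
  subgroup.\<close>

lemma generate_swap_elt:
  assumes "group X"
  shows "generate (swap_product X) {swap_elt X} = {\<one>\<^bsub>swap_product X\<^esub>, swap_elt X}"
proof -
  interpret G: group "swap_product X" by (rule group_swap_product[OF assms])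
  note s = swap_elt_order_2[OF assms]
  have inv: "inv\<^bsub>swap_product X\<^esub> swap_elt X = swap_elt X"
    using s by (simp add: G.inv_equality)
  have "subgroup {\<one>\<^bsub>swap_product X\<^esub>, swap_elt X} (swap_product X)"
    by (rule G.subgroupI) (use s inv in auto)
  then have "generate (swap_product X) {swap_elt X} \<subseteq> {\<one>\<^bsub>swap_product X\<^esub>, swap_elt X}"
    by (intro G.generate_subgroup_incl) auto
  moreover have "{\<one>\<^bsub>swap_product X\<^esub>, swap_elt X} \<subseteq> generate (swap_product X) {swap_elt X}"
    by (simp add: generate.one generate.incl)
  ultimately show ?thesis
    by (rule equalityI)
qed

lemma centralizer_swap_elt_eq_set_mult:
  assumes "group X"
  shows "centralizer (swap_product X) (swap_elt X)
    = diagonal X <#>\<^bsub>swap_product X\<^esub> generate (swap_product X) {swap_elt X}"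
proof -
  interpret X: group X by fact
  show ?thesis
    unfolding centralizer_swap_elt[OF assms] generate_swap_elt[OF assms]
  proof (intro equalityI subsetI)
    fix g :: "('a \<times> 'a) \<times> int"
    assume "g \<in> {((x, x), k) | x k. x \<in> carrier X \<and> k \<in> {0, 1}}"
    then obtain x k where g: "g = ((x, x), k)" "x \<in> carrier X" "k = 0 \<or> k = 1"
      by auto
    \<comment> \<open>Elements of \<open>diagonal X\<close> have residue 0, so the second factor has
      to supply \<open>k\<close>.\<close>
    let ?s = "if k = 0 then \<one>\<^bsub>swap_product X\<^esub> else swap_elt X"
    have "g = ((x, x), 0) \<otimes>\<^bsub>swap_product X\<^esub> ?s"
      using g by (auto simp: swap_elt_eq swap_product_simps)
    moreover have "((x, x), 0) \<in> diagonal X" "?s \<in> {\<one>\<^bsub>swap_product X\<^esub>, swap_elt X}"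
      using g by (auto simp: diagonal_def)
    ultimately show "g \<in> diagonal X <#>\<^bsub>swap_product X\<^esub> {\<one>\<^bsub>swap_product X\<^esub>, swap_elt X}"
      unfolding set_mult_def by blast
  qed (auto simp: set_mult_def diagonal_def swap_elt_eq swap_product_simps)
qed

lemma iso_diagonal:
  assumes "group X"
  shows "X \<cong> (swap_product X)\<lparr>carrier := diagonal X\<rparr>"
proof -
  have "(\<lambda>x. ((x, x), 0)) \<in> iso X ((swap_product X)\<lparr>carrier := diagonal X\<rparr>)"
    by (rule isoI) (auto simp: hom_def diagonal_def swap_product_simps bij_betw_def inj_on_def)
  then show ?thesis
    by (rule is_isoI)
qed

lemma virtually_abelian_if_virtual_retract:
  assumes X: "group X"
    and vr: "virtual_retract (centralizer (swap_product X) (swap_elt X)) (swap_product X)"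
  obtains B where "subgroup B X" "comm_group (X\<lparr>carrier := B\<rparr>)" "finite_index B X"
proof -
  interpret X: group X by fact
  let ?G = "swap_product X" and ?s = "swap_elt X"
  let ?A = "centralizer ?G ?s"
  interpret G: group ?G by (rule group_swap_product[OF X])
  obtain K \<rho> where K: "subgroup K ?G" "finite_index K ?G" "?A \<subseteq> K"
    and \<rho>: "\<rho> \<in> hom (?G\<lparr>carrier := K\<rparr>) (?G\<lparr>carrier := ?A\<rparr>)" and id: "\<And>h. h \<in> ?A \<Longrightarrow> \<rho> h = h"
    using vr by (auto simp: virtual_retract_def retract_of_def)
  interpret K: subgroup K ?G by fact
  \<comment> \<open>The embeddings of \<open>X\<close> as the first and the second direct
    factor.\<close>
  define l r :: "'a \<Rightarrow> ('a \<times> 'a) \<times> int"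
    where "l x = ((x, \<one>\<^bsub>X\<^esub>), 0)" and "r x = ((\<one>\<^bsub>X\<^esub>, x), 0)" for x
  define B where "B = {x \<in> carrier X. l x \<in> K}"
  have "l \<in> hom X ?G"
    by (auto simp: hom_def l_def swap_product_simps)
  note B = finite_index_vimage[OF X group_swap_product[OF X] this K(1,2), folded B_def]
  have sA: "?s \<in> ?A"
    using swap_elt_order_2[OF X] by (simp add: centralizer_def)
  have sK: "?s \<in> K"
    using sA K(3) by blast
  have mult: "\<rho> (u \<otimes>\<^bsub>?G\<^esub> v) = \<rho> u \<otimes>\<^bsub>?G\<^esub> \<rho> v" if "u \<in> K" "v \<in> K" for u v
    using hom_mult[OF \<rho>, of u v] that by simp
  have \<rho>_carrier: "\<rho> u \<in> carrier ?G" if "u \<in> K" for u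
    using hom_in_carrier[OF \<rho>, of u] that by (simp add: centralizer_def)
  have rK: "r x \<in> K" and \<rho>_eq: "\<rho> (r x) = \<rho> (l x)"
    and diag: "((x, x), 0) = \<rho> (l x) \<otimes>\<^bsub>?G\<^esub> \<rho> (l x)" if "x \<in> B" for x
  proof -
    have x: "x \<in> carrier X" "l x \<in> K"
      using that by (auto simp: B_def)
    \<comment> \<open>Since \<open>?s\<close> is an involution, this is conjugation by
      \<open>?s\<close>; it stays inside \<open>K\<close> because \<open>?s\<close> lies in
      \<open>K\<close>.\<close>
    have "?s \<otimes>\<^bsub>?G\<^esub> l x \<otimes>\<^bsub>?G\<^esub> ?s = r x"
      using x by (simp add: swap_elt_eq l_def r_def swap_product_simps)
    then show rK: "r x \<in> K"
      using x sK by (metis K.m_closed)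
    show \<rho>_eq: "\<rho> (r x) = \<rho> (l x)"
      by (rule hom_centralizer_conj_eq[OF group_swap_product[OF X] K(1) \<rho> sK id[OF sA] x(2) rK])
        (use x in \<open>simp add: swap_elt_eq l_def r_def swap_product_simps\<close>)
    \<comment> \<open>The diagonal element lies in \<open>?A\<close>, so \<open>\<rho>\<close> fixes
      it; applying \<open>\<rho>\<close> to this factorization turns it into a square.\<close>
    have "((x, x), 0) = l x \<otimes>\<^bsub>?G\<^esub> r x"
      using x by (simp add: l_def r_def swap_product_simps)
    moreover have "((x, x), 0) \<in> ?A"
      using x by (simp add: centralizer_swap_elt[OF X])
    ultimately show "((x, x), 0) = \<rho> (l x) \<otimes>\<^bsub>?G\<^esub> \<rho> (l x)"
      using id mult[OF x(2) rK] \<rho>_eq by metis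
  qed
  have comm: "x \<otimes>\<^bsub>X\<^esub> y = y \<otimes>\<^bsub>X\<^esub> x" if xy: "x \<in> B" "y \<in> B" for x y
  proof -
    have c: "x \<in> carrier X" "l x \<in> K" "y \<in> carrier X" "l y \<in> K"
      using xy by (auto simp: B_def)
    let ?u = "\<rho> (l x)" and ?v = "\<rho> (l y)"
    have uv: "?u \<in> carrier ?G" "?v \<in> carrier ?G"
      using c \<rho>_carrier by auto
    \<comment> \<open>Different direct factors commute. Replacing \<open>\<rho> (r y)\<close> by
      \<open>\<rho> (l y)\<close> then makes two images of the same factor commute.\<close>
    have "l x \<otimes>\<^bsub>?G\<^esub> r y = r y \<otimes>\<^bsub>?G\<^esub> l x"
      using c by (simp add: l_def r_def swap_product_simps)
    then have "?u \<otimes>\<^bsub>?G\<^esub> ?v = ?v \<otimes>\<^bsub>?G\<^esub> ?u"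
      using mult c rK[OF xy(2)] \<rho>_eq[OF xy(2)] by metis
    \<comment> \<open>Squares of commuting elements commute, and by \<open>diag\<close> these
      squares are the diagonal elements of \<open>x\<close> and \<open>y\<close>, from whose
      coordinates commutativity in \<open>X\<close> is read off.\<close>
    then have "(?u \<otimes>\<^bsub>?G\<^esub> ?u) \<otimes>\<^bsub>?G\<^esub> (?v \<otimes>\<^bsub>?G\<^esub> ?v) = (?v \<otimes>\<^bsub>?G\<^esub> ?v) \<otimes>\<^bsub>?G\<^esub> (?u \<otimes>\<^bsub>?G\<^esub> ?u)"
      using uv by (smt (verit) G.m_assoc G.m_closed)
    then have "((x, x), 0) \<otimes>\<^bsub>?G\<^esub> ((y, y), 0) = ((y, y), 0) \<otimes>\<^bsub>?G\<^esub> ((x, x), 0)"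
      using diag xy by simp
    then show ?thesis
      using c by (simp add: swap_product_simps)
  qed
  have "comm_group (X\<lparr>carrier := B\<rparr>)"
    by (rule group.group_comm_groupI[OF X.subgroup_imp_group[OF B(1)]]) (simp add: comm)
  then show thesis
    using that B by blast
qed

theorem proposition3p7:
  fixes X :: "('a, 'b) monoid_scheme"
  assumes "group X"
  shows "centralizer (swap_product X) (swap_elt X)
           = diagonal X <#>\<^bsub>swap_product X\<^esub> generate (swap_product X) {swap_elt X}
       \<and> X \<cong> (swap_product X)\<lparr>carrier := diagonal X\<rparr>
       \<and> (virtual_retract (centralizer (swap_product X) (swap_elt X)) (swap_product X) \<longrightarrow>
            (\<exists>B. subgroup B X \<and> comm_group (X\<lparr>carrier := B\<rparr>) \<and> finite_index B X))"
proof (intro conjI impI)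
  assume "virtual_retract (centralizer (swap_product X) (swap_elt X)) (swap_product X)"
  then obtain B where "subgroup B X" "comm_group (X\<lparr>carrier := B\<rparr>)" "finite_index B X"
    by (rule virtually_abelian_if_virtual_retract[OF assms])
  then show "\<exists>B. subgroup B X \<and> comm_group (X\<lparr>carrier := B\<rparr>) \<and> finite_index B X"
    by blast
qed (simp_all only: centralizer_swap_elt_eq_set_mult[OF assms] iso_diagonal[OF assms])

end
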